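(* For $n\ge0$ let $F_n(x)=\sum_{\pi\in\mathcal{S}_n}x^{\mathrm{lbsum}(\pi)}$. Then $F_0(x)=1$ and, for all $n\ge1$, $$F_n(x)=\sum_{k=1}^n\binom{n-1}{k-1}F_{k-1}(x)\,F_{n-k}(x)\,x^{k(n-k)}.$$
   Context: $\mathcal{S}_n$ is the set of permutations $\pi=\pi_1\cdots\pi_n$ of $\{1,\ldots,n\}$. The left border number $a_i$ of $\pi$ is the largest position $m<i$ with $\pi_m>\pi_i$, or $0$ if no such position exists, and $\mathrm{lbsum}(\pi)=a_1+\cdots+a_n$. *)

theory Defs
  imports "HOL-Combinatorics.Permutations" "HOL-Computational_Algebra.Polynomial"
begin

text \<open>Permutations in \<open>\<S>\<^sub>n\<close> are functions \<open>p\<close> with \<^term>\<open>p permutes {1..n}\<close>;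
  \<open>p i\<close> is the \<open>i\<close>-th letter of the one-line notation.\<close>

definition left_border :: "(nat \<Rightarrow> nat) \<Rightarrow> nat \<Rightarrow> nat" where
  "left_border p i = Max (insert 0 {m. 1 \<le> m \<and> m < i \<and> p m > p i})"

definition lbsum :: "nat \<Rightarrow> (nat \<Rightarrow> nat) \<Rightarrow> nat" where
  "lbsum n p = (\<Sum>i=1..n. left_border p i)"

text \<open>\<open>x\<close> is a formal indeterminate: \<^term>\<open>monom 1 k\<close> is \<open>x\<^sup>k\<close>.\<close>

definition F :: "nat \<Rightarrow> int poly" where
  "F n = (\<Sum>p | p permutes {1..n}. monom 1 (lbsum n p))"

end

theory Submission
  imports Defs "HOL-Combinatorics.Multiset_Permutations"
begin

text \<open>Splitting a permutation of length \<open>n\<close> at the position \<open>k\<close> of its largest letter leaves the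
  left borders before \<open>k\<close> unchanged, makes the one at \<open>k\<close> vanish, and shifts each of the \<open>n - k\<close>
  later ones by \<open>k\<close>. The two pieces are arbitrary words on complementary subsets of the
  remaining letters. Hence it is convenient to count words on an arbitrary finite set of letters:
  by induction the resulting polynomial depends only on the size of that set.\<close>

lemma lbsum_cong:
  assumes "\<And>i. 1 \<le> i \<Longrightarrow> i \<le> n \<Longrightarrow> f i = g i"
  shows "lbsum n f = lbsum n g"
proof -
  have "left_border f i = left_border g i" if "i \<in> {1..n}" for i
  proof -
    have "{m. 1 \<le> m \<and> m < i \<and> f m > f i} = {m. 1 \<le> m \<and> m < i \<and> g m > g i}"
      using that assms by auto
    then show ?thesis by (simp add: left_border_def)
  qed
  then show ?thesis by (simp add: lbsum_def)
qed

text \<open>Position \<open>k\<close> holds a larger letter than position \<open>k + j\<close>, so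
  the left border of \<open>k + j\<close> is at least \<open>k\<close>. Only positions from
  \<open>k\<close> on compete, and \<open>k\<close> itself takes the role of the default value 0 for
  the shifted word.\<close>

lemma left_border_shift:
  assumes "f (k + j) < f k" "1 \<le> k" "1 \<le> j"
  shows "left_border f (k + j) = k + left_border (\<lambda>i. f (k + i)) j"
proof -
  let ?S = "{m. 1 \<le> m \<and> m < k + j \<and> f m > f (k + j)}"
  let ?T = "insert 0 {m. 1 \<le> m \<and> m < j \<and> f (k + m) > f (k + j)}"
  have fin: "finite ?S" "finite ?T" by auto
  have "Max (insert 0 ?S) = k + Max ?T"
  proof (rule Max_eqI)
    show "k + Max ?T \<in> insert 0 ?S"
      using Max_in[OF fin(2)] assms by auto
  next
    fix y assume y: "y \<in> insert 0 ?S"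
    show "y \<le> k + Max ?T"
    proof (cases "y \<le> k")
      case False
      with y have "y - k \<in> ?T" by auto
      then have "y - k \<le> Max ?T" using fin(2) by (rule Max_ge[rotated])
      then show ?thesis by simp
    qed simp
  qed (use fin in simp)
  then show ?thesis by (simp add: left_border_def)
qed

lemma lbsum_split_at_max:
  assumes k: "1 \<le> k" "k \<le> n"
    and max: "\<And>i. 1 \<le> i \<Longrightarrow> i \<le> n \<Longrightarrow> i \<noteq> k \<Longrightarrow> f i < f k"
  shows "lbsum n f = lbsum (k - 1) f + lbsum (n - k) (\<lambda>i. f (k + i)) + k * (n - k)"
proof -
  have "{m. 1 \<le> m \<and> m < k \<and> f m > f k} = {}"
    using max k by (auto simp: not_less intro: less_imp_le)
  then have at_max: "left_border f k = 0"
    unfolding left_border_def by (simp only: Max_singleton)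
  have "{1..n} = {1..k - 1} \<union> {k} \<union> {k + 1..n}"
    using k by auto
  \<comment> \<open>\<open>left_border f i\<close> inspects only \<open>i\<close> and earlier
    positions, so the terms with \<open>i < k\<close> already form
    \<open>lbsum (k - 1) f\<close>.\<close>
  then have "lbsum n f = lbsum (k - 1) f + (\<Sum>i=k+1..n. left_border f i)"
    using k unfolding lbsum_def
    by (subst \<open>{1..n} = _\<close>, subst sum.union_disjoint) (auto simp: sum.union_disjoint at_max)
  also have "(\<Sum>i=k+1..n. left_border f i) = (\<Sum>j=1..n-k. left_border f (k + j))"
    by (rule sum.reindex_bij_witness[of _ "\<lambda>j. k + j" "\<lambda>i. i - k"]) auto
  also have "\<dots> = (\<Sum>j=1..n-k. k + left_border (\<lambda>i. f (k + i)) j)"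
    by (intro sum.cong refl left_border_shift max) (use k in auto)
  also have "\<dots> = k * (n - k) + lbsum (n - k) (\<lambda>i. f (k + i))"
    by (simp add: sum.distrib lbsum_def)
  finally show ?thesis by simp
qed

text \<open>Words are lists, so that letters may come from any finite set and a word with a marked
  letter is an append. The index \<open>i - 1\<close> translates the 1-based positions of
  \<open>lbsum\<close> into list indices.\<close>

definition word_lbsum :: "nat list \<Rightarrow> nat" where
  "word_lbsum xs = lbsum (length xs) (\<lambda>i. xs ! (i - 1))"

definition words_gf :: "nat set \<Rightarrow> int poly" where
  "words_gf V = (\<Sum>xs\<in>permutations_of_set V. monom 1 (word_lbsum xs))"

lemma word_lbsum_append_max:
  assumes "\<And>y. y \<in> set ys \<union> set zs \<Longrightarrow> y < M"
  shows "word_lbsum (ys @ M # zs) =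
    word_lbsum ys + word_lbsum zs + Suc (length ys) * length zs"
proof -
  \<comment> \<open>\<open>?k\<close> is the 1-based position of \<open>M\<close>; for
    \<open>i \<ge> 1\<close> the letter at position \<open>?k + i\<close> is
    \<open>zs ! (i - 1)\<close>.\<close>
  let ?f = "\<lambda>i. (ys @ M # zs) ! (i - 1)" and ?k = "Suc (length ys)"
    and ?n = "length (ys @ M # zs)"
  have "?f i < ?f ?k" if "1 \<le> i" "i \<le> ?n" "i \<noteq> ?k" for i
    using that assms by (auto simp: nth_append nth_Cons' intro!: nth_mem)
  then have "word_lbsum (ys @ M # zs) =
      lbsum (?k - 1) ?f + lbsum (?n - ?k) (\<lambda>i. ?f (?k + i)) + ?k * (?n - ?k)"
    unfolding word_lbsum_def by (intro lbsum_split_at_max) auto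
  also have "lbsum (?k - 1) ?f = word_lbsum ys"
    unfolding word_lbsum_def by (simp, rule lbsum_cong) (auto simp: nth_append)
  also have "lbsum (?n - ?k) (\<lambda>i. ?f (?k + i)) = word_lbsum zs"
    unfolding word_lbsum_def by (simp, rule lbsum_cong) (auto simp: nth_append nth_Cons')
  finally show ?thesis by simp
qed

text \<open>One-line notation turns a permutation \<open>p\<close> into the list
  \<open>map p [1..<Suc n]\<close> with the same left borders, and this is a bijection onto the
  words on \<open>{1..n}\<close>.\<close>

lemma F_eq_words_gf: "F n = words_gf {1..n}"
proof -
  let ?P = "{p. p permutes {1..n}}" and ?h = "\<lambda>p::nat \<Rightarrow> nat. map p [1..<Suc n]"
  have inj: "inj_on ?h ?P"
  proof (rule inj_onI)
    fix p q assume pq: "p \<in> ?P" "q \<in> ?P" "?h p = ?h q"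
    then have eq: "p i = q i" if "i \<in> {1..n}" for i
      using that by (simp add: map_eq_conv del: upt_Suc)
    show "p = q"
    proof
      \<comment> \<open>The lists determine the values on \<open>{1..n}\<close>; elsewhere both
        permutations are the identity.\<close>
      fix i show "p i = q i"
        using eq[of i] pq by (cases "i \<in> {1..n}") (auto simp: permutes_not_in)
    qed
  qed
  have sub: "?h ` ?P \<subseteq> permutations_of_set {1..n}"
  proof clarify
    fix p assume p: "p permutes {1..n}"
    show "?h p \<in> permutations_of_set {1..n}"
    proof (rule permutations_of_setI)
      show "set (?h p) = {1..n}"
        using permutes_image[OF p] by (simp add: atLeastLessThanSuc_atLeastAtMost del: upt_Suc)
      show "distinct (?h p)"
        using permutes_inj_on[OF p] by (simp add: distinct_map del: upt_Suc)
    qed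
  qed
  \<comment> \<open>Surjectivity follows by counting: both sets have \<open>fact n\<close>
    elements.\<close>
  have "card (?h ` ?P) = card (permutations_of_set {1..n})"
    by (subst card_image[OF inj], subst card_permutations[of "{1..n}" n]) simp_all
  then have "?h ` ?P = permutations_of_set {1..n}"
    by (intro card_subset_eq[OF _ sub]) simp_all
  then have "bij_betw ?h ?P (permutations_of_set {1..n})"
    using inj by (simp add: bij_betw_def del: upt_Suc)
  then have "words_gf {1..n} = (\<Sum>p\<in>?P. monom 1 (word_lbsum (?h p)))"
    unfolding words_gf_def by (rule sum.reindex_bij_betw[symmetric])
  also have "\<dots> = (\<Sum>p\<in>?P. monom 1 (lbsum n p))"
  proof -
    have "word_lbsum (?h p) = lbsum n p" for p
      unfolding word_lbsum_def by (simp del: upt_Suc, rule lbsum_cong) (simp del: upt_Suc)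
    then show ?thesis by presburger
  qed
  finally show ?thesis by (simp add: F_def)
qed

text \<open>A word is determined by the set \<open>A\<close> of letters left of its maximum together
  with the words on \<open>A\<close> and \<open>U - A\<close>; for fixed \<open>A\<close> the sum
  over such pairs factors. The exponent is the position \<open>Suc (card A)\<close> of the maximum
  times the number of letters after it.\<close>

lemma words_gf_split_at_Max:
  assumes "finite V" "V \<noteq> {}"
  defines "U \<equiv> V - {Max V}"
  shows "words_gf V = (\<Sum>A\<in>Pow U. words_gf A * words_gf (U - A) *
    monom 1 (Suc (card A) * (card U - card A)))"
proof -
  let ?M = "Max V"
  let ?D = "SIGMA A:Pow U. permutations_of_set A \<times> permutations_of_set (U - A)"
  let ?h = "\<lambda>(A::nat set, ys, zs). ys @ ?M # zs"
  have finU: "finite U" using assms by simp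
  have in_V: "x \<in> V \<longleftrightarrow> x = ?M \<or> x \<in> U" for x
    using Max_in[OF assms(1,2)] by (auto simp: U_def)
  have M: "?M \<notin> U" by (simp add: U_def)
  have less: "y < ?M" if "y \<in> U" for y
    using that assms(1) Max_ge[of V y] by (auto simp: U_def less_le)
  have inj: "inj_on ?h ?D"
  proof (rule inj_onI)
    fix s t assume st: "s \<in> ?D" "t \<in> ?D" "?h s = ?h t"
    obtain A ys zs A' ys' zs' where eqs: "s = (A, ys, zs)" "t = (A', ys', zs')"
      by (cases s, cases t) auto
    with st have *: "A \<subseteq> U" "ys \<in> permutations_of_set A" "zs \<in> permutations_of_set (U - A)"
      "A' \<subseteq> U" "ys' \<in> permutations_of_set A'" "zs' \<in> permutations_of_set (U - A')"
      "ys @ ?M # zs = ys' @ ?M # zs'"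
      by auto
    \<comment> \<open>The maximum occurs only at the cut, so the list reveals where it was cut;
      \<open>A\<close> is then recovered as \<open>set ys\<close>.\<close>
    then have "?M \<notin> set ys" "?M \<notin> set zs" "?M \<notin> set ys'"
      using M by (auto dest!: permutations_of_setD(1))
    then have "ys = ys' \<and> zs = zs'"
      using * by (simp add: append_Cons_eq_iff)
    then show "s = t"
      using * by (auto simp: eqs dest!: permutations_of_setD(1))
  qed
  have img: "?h ` ?D = permutations_of_set V"
  proof (intro equalityI subsetI)
    fix xs assume "xs \<in> ?h ` ?D"
    then show "xs \<in> permutations_of_set V"
      using M in_V by (auto simp: permutations_of_set_def)
  next
    fix xs assume xs: "xs \<in> permutations_of_set V"
    then have "?M \<in> set xs" using in_V by (simp add: permutations_of_set_def)
    then obtain ys zs where eq: "xs = ys @ ?M # zs" by (meson split_list)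
    \<comment> \<open>Distinctness of \<open>xs\<close> makes the two sets of letters complementary
      in \<open>U\<close>, so \<open>set ys\<close> serves as \<open>A\<close>.\<close>
    with xs have "set ys \<union> set zs = U" "set ys \<inter> set zs = {}" "distinct ys" "distinct zs"
      by (auto simp: permutations_of_set_def U_def)
    then have "(set ys, ys, zs) \<in> ?D" by (auto simp: permutations_of_set_def)
    then show "xs \<in> ?h ` ?D" by (rule rev_image_eqI) (simp add: eq)
  qed
  have "words_gf V = (\<Sum>t\<in>?D. monom 1 (word_lbsum (?h t)))"
    unfolding words_gf_def by (subst img[symmetric], subst sum.reindex[OF inj]) (simp add: comp_def)
  also have "\<dots> = (\<Sum>A\<in>Pow U. \<Sum>ys\<in>permutations_of_set A.
      \<Sum>zs\<in>permutations_of_set (U - A). monom 1 (word_lbsum (ys @ ?M # zs)))"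
    using finU by (subst sum.cartesian_product, subst sum.Sigma) (simp_all add: split_def)
  also have "\<dots> = (\<Sum>A\<in>Pow U. \<Sum>ys\<in>permutations_of_set A. \<Sum>zs\<in>permutations_of_set (U - A).
      monom 1 (word_lbsum ys) * monom 1 (word_lbsum zs) *
      monom 1 (Suc (card A) * (card U - card A)))"
  proof (intro sum.cong refl)
    fix A ys zs
    assume A: "A \<in> Pow U" and ys: "ys \<in> permutations_of_set A"
      and zs: "zs \<in> permutations_of_set (U - A)"
    have len: "length ys = card A" "length zs = card U - card A"
      using A ys zs finU
      by (simp_all add: length_finite_permutations_of_set card_Diff_subset finite_subset)
    have "y < ?M" if "y \<in> set ys \<union> set zs" for y
    proof (rule less)
      show "y \<in> U"
        using that A permutations_of_setD(1)[OF ys] permutations_of_setD(1)[OF zs] by auto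
    qed
    then have "word_lbsum (ys @ ?M # zs) =
        word_lbsum ys + word_lbsum zs + Suc (card A) * (card U - card A)"
      using word_lbsum_append_max[of ys zs ?M] unfolding len by blast
    then show "(monom 1 (word_lbsum (ys @ ?M # zs)) :: int poly) =
        monom 1 (word_lbsum ys) * monom 1 (word_lbsum zs) *
        monom 1 (Suc (card A) * (card U - card A))"
      by (simp only: mult_monom mult_1)
  qed
  also have "\<dots> = (\<Sum>A\<in>Pow U. words_gf A * words_gf (U - A) *
      monom 1 (Suc (card A) * (card U - card A)))"
    unfolding words_gf_def sum_product by (simp only: sum_distrib_right)
  finally show ?thesis .
qed

text \<open>Group the subsets by cardinality; \<open>n_subsets\<close> counts each class.\<close>

lemma sum_Pow_card:
  fixes h :: "nat \<Rightarrow> 'a :: semiring_1"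
  assumes "finite U"
  shows "(\<Sum>A\<in>Pow U. h (card A)) = (\<Sum>j\<le>card U. of_nat (card U choose j) * h j)"
proof -
  have "(\<Sum>A\<in>Pow U. h (card A)) =
      (\<Sum>j\<le>card U. \<Sum>A\<in>{A \<in> Pow U. card A = j}. h (card A))"
    using assms by (intro sum.group[symmetric]) (auto intro: card_mono)
  also have "\<dots> = (\<Sum>j\<le>card U. of_nat (card U choose j) * h j)"
    using n_subsets[OF assms] by (intro sum.cong refl) simp
  finally show ?thesis .
qed

text \<open>The right-hand side depends on \<open>V\<close> only through \<open>card V\<close>.
  Having the claim for smaller sets as a hypothesis lets the recursion serve twice: inside the
  induction that proves this claim, and afterwards for the theorem itself.\<close>

lemma words_gf_recursion_step:
  assumes "finite V" "V \<noteq> {}" and IH: "\<And>A. finite A \<Longrightarrow> card A < card V \<Longrightarrow> words_gf A = F (card A)"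
  shows "words_gf V = (\<Sum>j\<le>card V - 1. of_nat (card V - 1 choose j) *
    (F j * F (card V - 1 - j) * monom 1 (Suc j * (card V - 1 - j))))"
proof -
  define U where "U = V - {Max V}"
  have U: "finite U" "card U = card V - 1" "card U < card V"
    using assms by (auto simp: U_def card_Diff_singleton card_gt_0_iff)
  have "words_gf V = (\<Sum>A\<in>Pow U. words_gf A * words_gf (U - A) *
      monom 1 (Suc (card A) * (card U - card A)))"
    unfolding U_def using assms by (intro words_gf_split_at_Max)
  also have "\<dots> = (\<Sum>A\<in>Pow U. F (card A) * F (card U - card A) *
      monom 1 (Suc (card A) * (card U - card A)))"
  proof (rule sum.cong[OF refl])
    fix A assume "A \<in> Pow U"
    then have "finite A" "card A \<le> card U" "card (U - A) = card U - card A"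
      using U(1) by (auto simp: finite_subset card_mono card_Diff_subset)
    \<comment> \<open>Both blocks have at most \<open>card U < card V\<close> letters, so
      \<open>IH\<close> applies to each.\<close>
    then have "words_gf A = F (card A)" "words_gf (U - A) = F (card U - card A)"
      using IH[of A] IH[of "U - A"] U by auto
    then show "words_gf A * words_gf (U - A) * monom 1 (Suc (card A) * (card U - card A)) =
        F (card A) * F (card U - card A) * monom 1 (Suc (card A) * (card U - card A))"
      by simp
  qed
  finally show ?thesis
    using sum_Pow_card[OF U(1), of "\<lambda>j. F j * F (card U - j) * monom 1 (Suc j * (card U - j))"]
    by (simp only: U(2))
qed

lemma words_gf_eq_F: "finite V \<Longrightarrow> words_gf V = F (card V)"
proof (induction "card V" arbitrary: V rule: less_induct)
  case less
  show ?case
  proof (cases "V = {}")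
    case True
    then show ?thesis by (simp add: F_eq_words_gf)
  next
    case False
    with less.prems have "{1..card V} \<noteq> {}" by (simp add: Suc_le_eq card_gt_0_iff)
    \<comment> \<open>The two sets have the same size, so the induction hypothesis yields the
      recursion for both, with identical right-hand sides.\<close>
    then have "words_gf {1..card V} = words_gf V"
      using words_gf_recursion_step[OF less.prems False less.hyps]
        words_gf_recursion_step[of "{1..card V}", OF _ _ less.hyps] by simp
    then show ?thesis by (simp add: F_eq_words_gf[of "card V"])
  qed
qed

theorem proposition2p2:
  "F 0 = 1 \<and>
   (\<forall>n\<ge>1. F n = (\<Sum>k=1..n. of_nat ((n - 1) choose (k - 1)) * F (k - 1) * F (n - k)
                              * monom 1 (k * (n - k))))"
proof (intro conjI allI impI)
  show "F 0 = 1"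
    by (simp add: F_def lbsum_def)
next
  fix n :: nat assume n: "1 \<le> n"
  \<comment> \<open>The claim about smaller sets is now available for all finite sets, so the
    recursion holds for \<open>{1..n}\<close>.\<close>
  then have "F n = (\<Sum>j\<le>n - 1. of_nat (n - 1 choose j) *
      (F j * F (n - 1 - j) * monom 1 (Suc j * (n - 1 - j))))"
    using words_gf_recursion_step[of "{1..n}", OF _ _ words_gf_eq_F]
    by (simp add: F_eq_words_gf[of n])
  \<comment> \<open>Substituting \<open>k = Suc j\<close> passes from the number \<open>j\<close> of
    letters before the maximum to its position \<open>k\<close>.\<close>
  also have "\<dots> = (\<Sum>k=1..n. of_nat ((n - 1) choose (k - 1)) * F (k - 1) * F (n - k)
      * monom 1 (k * (n - k)))"
    by (rule sum.reindex_bij_witness[of _ "\<lambda>k. k - 1" Suc]) (use n in \<open>auto simp: mult.assoc\<close>)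
  finally show "F n = (\<Sum>k=1..n. of_nat ((n - 1) choose (k - 1)) * F (k - 1) * F (n - k)
      * monom 1 (k * (n - k)))" .
qed

end
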